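(* For all positive integers $k\le r$ there exists $\alpha_0>0$ such that for every $\alpha\in(0,\alpha_0)$ there exists $n_0$ such that for every $n\ge n_0$ the following holds. Let $V$ be partitioned into $r$ parts $V_1,\dots,V_r$ each of size $n$, and let $J$ be a $k$-system on $V$ which is partite with respect to this partition and satisfies $$\delta^*(J) \geq \left(n, \left(\tfrac{k-1}{k} - \alpha\right)n, \left(\tfrac{k-2}{k} - \alpha\right) n, \dots, \left(\tfrac{1}{k} - \alpha\right) n\right).$$ Then $J_k$ contains a matching which covers all but at most $9k^2r\alpha n$ vertices of $J$.
   Context: A $k$-system is a hypergraph $J$ (identified with its edge set) in which every edge has size at most $k$ and $\emptyset\in J$; $J_r$ denotes the $r$-graph of its edges of size $r$. A set is partite with respect to a partition if it has at most one vertex in each part; $J$ is partite if all its edges are. The partite minimum $j$-degree is $\delta^*_j(J) = \min_{e\in J_j}\min_{i:\, e\cap V_i=\emptyset} |\{v\in V_i: e\cup\{v\}\in J\}|$, and $\delta^*(J)=(\delta^*_0(J),\dots,\delta^*_{k-1}(J))$, compared pointwise. A matching is a set of pairwise disjoint edges. *)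

theory Defs
  imports "HOL-Analysis.Analysis"
begin

definition vertex_set :: "(nat \<Rightarrow> 'a set) \<Rightarrow> nat \<Rightarrow> 'a set" where
  "vertex_set V r = (\<Union>i<r. V i)"

definition equi_partition :: "(nat \<Rightarrow> 'a set) \<Rightarrow> nat \<Rightarrow> nat \<Rightarrow> bool" where
  "equi_partition V r n \<longleftrightarrow>
     (\<forall>i<r. finite (V i) \<and> card (V i) = n) \<and>
     (\<forall>i<r. \<forall>i'<r. i \<noteq> i' \<longrightarrow> V i \<inter> V i' = {})"

definition k_system :: "nat \<Rightarrow> 'a set \<Rightarrow> 'a set set \<Rightarrow> bool" where
  "k_system k W J \<longleftrightarrow> {} \<in> J \<and> (\<forall>e\<in>J. e \<subseteq> W \<and> finite e \<and> card e \<le> k)"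

definition layer :: "'a set set \<Rightarrow> nat \<Rightarrow> 'a set set" where
  "layer J r = {e \<in> J. card e = r}"

definition partite_set :: "(nat \<Rightarrow> 'a set) \<Rightarrow> nat \<Rightarrow> 'a set \<Rightarrow> bool" where
  "partite_set V r e \<longleftrightarrow> (\<forall>i<r. card (e \<inter> V i) \<le> 1)"

definition partite :: "(nat \<Rightarrow> 'a set) \<Rightarrow> nat \<Rightarrow> 'a set set \<Rightarrow> bool" where
  "partite V r J \<longleftrightarrow> (\<forall>e\<in>J. partite_set V r e)"

text \<open>Partite minimum j-degree; the minimum over an empty set is +infinity.\<close>
definition partite_min_degree ::
  "(nat \<Rightarrow> 'a set) \<Rightarrow> nat \<Rightarrow> 'a set set \<Rightarrow> nat \<Rightarrow> ereal" where
  "partite_min_degree V r J j =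
     (INF e\<in>layer J j. INF i\<in>{i. i < r \<and> e \<inter> V i = {}}.
        ereal (real (card {v \<in> V i. e \<union> {v} \<in> J})))"

definition matching :: "'a set set \<Rightarrow> bool" where
  "matching M \<longleftrightarrow> (\<forall>e\<in>M. \<forall>f\<in>M. e \<noteq> f \<longrightarrow> e \<inter> f = {})"

end

theory Submission
  imports Defs
begin

text \<open>
  For any nonnegative vertex weights and any \<open>k\<close> of the parts, the degree conditions give an edge whose
  weight is at most the sum of the average weights of these parts: extend greedily by the lightest
  available vertex, and average over the \<open>k\<close> cyclic orders of the parts. Edges are now
  removed one at a time. The weights come from an exponential potential which penalises every
  neighbourhood whose density in the remaining vertices has dropped; always removing a light edge
  keeps the potential almost constant, so all relative degrees survive up to an arbitrarily small
  error until only a small proportion of the vertices is left. To absorb this error and the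
  \<open>\<alpha>\<close> in the hypothesis, each part is first padded with about \<open>2 k \<alpha> n\<close> new vertices that may extend
  any edge; the matching edges that contain a padding vertex are discarded at the end.
\<close>

section \<open>Light edges\<close>

lemma has_integral_indicator_less:
  fixes x B :: real
  assumes "0 \<le> x" "x \<le> B"
  shows "((\<lambda>t. of_bool (t < x)) has_integral x) {0..B}"
proof -
  have "((\<lambda>t. 1::real) has_integral x) {0..x}"
    using has_integral_const_real[of "1::real" 0 x] assms by simp
  then have "((\<lambda>t. if t \<in> {0..x} then 1 else 0::real) has_integral x) {0..B}"
    using assms by (subst has_integral_restrict) auto
  then show ?thesis
    by (rule has_integral_spike_finite[of "{x}", rotated 2]) (auto simp: of_bool_def)
qed

text \<open>Layer-cake argument: a value \<open>x\<close> in \<open>{0..B}\<close> is the integral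
  over \<open>t\<close> of the indicator of \<open>t < x\<close>, so each sum is the integral of the
  sizes of its strict level sets. Taking the total of both sums as \<open>B\<close> bounds all
  values at once.\<close>

lemma sum_le_by_layers:
  fixes a :: "'i \<Rightarrow> real" and b :: "'j \<Rightarrow> real"
  assumes fin: "finite I" "finite K"
    and a: "\<And>i. i \<in> I \<Longrightarrow> 0 \<le> a i" and b: "\<And>j. j \<in> K \<Longrightarrow> 0 \<le> b j"
    and layers: "\<And>t. 0 \<le> t \<Longrightarrow> real (card {i \<in> I. t < a i}) \<le> c * real (card {j \<in> K. t < b j})"
  shows "sum a I \<le> c * sum b K"
proof -
  define B where "B = sum a I + sum b K"
  have aB: "a i \<le> B" if "i \<in> I" for i
    using member_le_sum[of i I a] that fin a b sum_nonneg[of K b] by (auto simp: B_def intro: add_increasing2)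
  have bB: "b j \<le> B" if "j \<in> K" for j
    using member_le_sum[of j K b] that fin a b sum_nonneg[of I a] by (auto simp: B_def intro: add_increasing)
  have "((\<lambda>t. \<Sum>i\<in>I. of_bool (t < a i)) has_integral sum a I) {0..B}"
    by (intro has_integral_sum fin has_integral_indicator_less a aB)
  moreover have "((\<lambda>t. c * (\<Sum>j\<in>K. of_bool (t < b j))) has_integral c * sum b K) {0..B}"
    by (intro has_integral_mult_right has_integral_sum fin has_integral_indicator_less b bB)
  moreover have "(\<Sum>i\<in>I. of_bool (t < a i)) \<le> c * (\<Sum>j\<in>K. of_bool (t < b j))" if "t \<in> {0..B}" for t
    using layers[of t] that fin by (simp add: sum_of_bool_eq Int_def)
  ultimately show ?thesis
    by (rule has_integral_le)
qed

text \<open>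
  Taking \<open>q j\<close> to be the largest possible minimum of \<open>g\<close> on an admissible \<open>N\<close> makes the second claim a
  comparison of level sets.
\<close>

lemma quantile_bounds:
  fixes g :: "'a \<Rightarrow> real"
  assumes A: "finite A" "A \<noteq> {}" and g: "\<And>v. v \<in> A \<Longrightarrow> 0 \<le> g v"
  obtains q :: "nat \<Rightarrow> real" where
    "\<And>j N. j < k \<Longrightarrow> N \<subseteq> A \<Longrightarrow> (k - j) * card A \<le> k * card N \<Longrightarrow> \<exists>v\<in>N. g v \<le> q j"
    and "(\<Sum>j<k. q j) \<le> real k * ((\<Sum>v\<in>A. g v) / real (card A))"
proof -
  define big where "big j = {N. N \<subseteq> A \<and> (k - j) * card A \<le> k * card N}" for j
  define q where "q j = Max ((\<lambda>N. Min (g ` N)) ` big j)" for j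
  have cA: "card A > 0" using A by (simp add: card_gt_0_iff)
  have fin_big: "finite (big j)" for j
    using A by (auto simp: big_def intro: finite_subset[of _ "Pow A"])
  have ne: "N \<noteq> {}" "finite N" "N \<subseteq> A" if "N \<in> big j" "j < k" for N j
    using that cA A finite_subset by (auto simp: big_def)
  have A_big: "A \<in> big j" for j by (auto simp: big_def)
  have q_max: "\<exists>N\<in>big j. q j = Min (g ` N)" for j
    using Max_in[of "(\<lambda>N. Min (g ` N)) ` big j"] fin_big A_big[of j] unfolding q_def by fast
  have 1: "\<exists>v\<in>N. g v \<le> q j" if "j < k" "N \<in> big j" for j N
  proof -
    have "Min (g ` N) \<le> q j" unfolding q_def using fin_big that by simp
    moreover have "Min (g ` N) \<in> g ` N" using ne[OF that(2,1)] by (intro Min_in) auto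
    ultimately show ?thesis by force
  qed
  have q0: "0 \<le> q j" if jk: "j < k" for j
  proof -
    obtain v where v: "v \<in> A" "g v \<le> q j" using 1[OF jk A_big] by blast
    then show ?thesis using g[of v] by linarith
  qed
  have "sum q {..<k} \<le> (real k / real (card A)) * sum g A"
  proof (rule sum_le_by_layers)
    fix t :: real
    define X where "X = k * card {v \<in> A. t < g v}"
    \<comment> \<open>If \<open>t < q j\<close>, an admissible set attaining \<open>q j\<close> lies
      inside the level set of \<open>g\<close>, which therefore has at least
      \<open>(k - j) * card A / k\<close> elements. The numbers \<open>k - j\<close> are distinct
      and positive, so counting such \<open>j\<close> reduces to bounding the largest
      \<open>k - j\<close>.\<close>
    have "k - j \<in> {1..X div card A}" if j: "j < k" "t < q j" for j
    proof -
      obtain N where N: "N \<in> big j" "q j = Min (g ` N)" using q_max by blast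
      have "t < g v" if "v \<in> N" for v
        using order.strict_trans2[OF j(2)[unfolded N(2)] Min_le[of "g ` N" "g v"]] that ne(2)[OF N(1) j(1)]
        by blast
      then have "N \<subseteq> {v \<in> A. t < g v}" using ne(3)[OF N(1) j(1)] by blast
      then have "card N \<le> card {v \<in> A. t < g v}" using A by (intro card_mono) auto
      then have "k * card N \<le> X" by (simp add: X_def)
      then have "(k - j) * card A \<le> X" using N(1) unfolding big_def by simp
      then have "k - j \<le> X div card A" using cA by (simp add: less_eq_div_iff_mult_less_eq)
      then show ?thesis using j by simp
    qed
    then have "card ((\<lambda>j. k - j) ` {j \<in> {..<k}. t < q j}) \<le> card {1..X div card A}"
      by (intro card_mono) auto
    moreover have "inj_on (\<lambda>j. k - j) {j \<in> {..<k}. t < q j}" by (auto simp: inj_on_def)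
    ultimately have "card {j \<in> {..<k}. t < q j} \<le> X div card A" by (simp add: card_image)
    then have "real (card {j \<in> {..<k}. t < q j}) \<le> real (X div card A)" by simp
    also have "\<dots> \<le> real X / real (card A)" by (rule of_nat_div_le_of_nat)
    finally show "real (card {j \<in> {..<k}. t < q j}) \<le> real k / real (card A) * real (card {v \<in> A. t < g v})"
      by (simp add: X_def)
  qed (use A g q0 in auto)
  then have 2: "(\<Sum>j<k. q j) \<le> real k * ((\<Sum>v\<in>A. g v) / real (card A))" by simp
  show thesis
    by (rule that[of q]) (use 1 2 in \<open>auto simp: big_def\<close>)
qed

section \<open>Greedy extension along cyclic orders of the parts\<close>

lemma bij_betw_add_mod:
  "bij_betw (\<lambda>j. (c + j) mod k) {..<k} {..<k::nat}"
proof (cases "k = 0")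
  case False
  have "inj_on (\<lambda>j. (c + j) mod k) {..<k}"
  proof (rule inj_onI)
    fix x y assume *: "x \<in> {..<k}" "y \<in> {..<k}" "(c + x) mod k = (c + y) mod k"
    \<comment> \<open>Adding \<open>c * (k - 1)\<close> cancels \<open>c\<close> modulo
      \<open>k\<close> without subtraction in the naturals.\<close>
    have "(c + x + c * (k - 1)) mod k = (c + y + c * (k - 1)) mod k"
      using *(3) by (metis mod_add_left_eq)
    then have "(x + c * k) mod k = (y + c * k) mod k"
      using False by (cases k) (simp_all add: algebra_simps)
    then show "x = y" using * by simp
  qed
  moreover have "(\<lambda>j. (c + j) mod k) ` {..<k} \<subseteq> {..<k}" using False by auto
  ultimately show ?thesis
    by (simp add: bij_betw_def endo_inj_surj)
qed auto

text \<open>\<open>ext\<close> gives each edge of size \<open>j\<close> at least the density at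
  which \<open>quantile_bounds\<close> offers a vertex of weight at most \<open>q a j\<close>. An
  order of the parts thus costs at most the sum of the quantiles at its (part, position) pairs; the
  \<open>k\<close> cyclic orders use each pair once, so the cheapest of them meets the claimed
  bound.\<close>

lemma light_edge:
  fixes W :: "nat \<Rightarrow> 'a set" and g :: "'a \<Rightarrow> real"
  assumes k: "0 < k"
    and W: "\<And>a. a < k \<Longrightarrow> finite (W a)" "\<And>a. a < k \<Longrightarrow> W a \<noteq> {}"
    and disj: "\<And>a b. a < k \<Longrightarrow> b < k \<Longrightarrow> a \<noteq> b \<Longrightarrow> W a \<inter> W b = {}"
    and g: "\<And>v. 0 \<le> g v"
    and empty: "{} \<in> J"
    and ext: "\<And>e a. e \<in> J \<Longrightarrow> e \<subseteq> (\<Union>b<k. W b) \<Longrightarrow> card e < k \<Longrightarrow> a < k \<Longrightarrow> e \<inter> W a = {} \<Longrightarrow>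
      (k - card e) * card (W a) \<le> k * card {v \<in> W a. insert v e \<in> J}"
  obtains u where "u ` {..<k} \<in> J" "\<And>a. a < k \<Longrightarrow> u a \<in> W a"
    "(\<Sum>a<k. g (u a)) \<le> (\<Sum>a<k. (\<Sum>v\<in>W a. g v) / real (card (W a)))"
proof -
  define Q where "Q a q \<longleftrightarrow>
      (\<forall>j N. j < k \<longrightarrow> N \<subseteq> W a \<longrightarrow> (k - j) * card (W a) \<le> k * card N \<longrightarrow> (\<exists>v\<in>N. g v \<le> q j)) \<and>
      (\<Sum>j<k. q j) \<le> real k * ((\<Sum>v\<in>W a. g v) / real (card (W a)))" for a and q :: "nat \<Rightarrow> real"
  have "\<exists>q. Q a q" if "a < k" for a
  proof (rule quantile_bounds[OF W(1)[OF that] W(2)[OF that], of g k])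
    fix q assume "\<And>j N. j < k \<Longrightarrow> N \<subseteq> W a \<Longrightarrow> (k - j) * card (W a) \<le> k * card N \<Longrightarrow> \<exists>v\<in>N. g v \<le> q j"
      "(\<Sum>j<k. q j) \<le> real k * ((\<Sum>v\<in>W a. g v) / real (card (W a)))"
    then have "Q a q" unfolding Q_def by blast
    then show "\<exists>q. Q a q" by blast
  qed (rule g)
  then obtain q where q: "\<And>a. a < k \<Longrightarrow> Q a (q a)" by metis
  have q1: "\<exists>v\<in>N. g v \<le> q a j"
    if "a < k" "j < k" "N \<subseteq> W a" "(k - j) * card (W a) \<le> k * card N" for a j N
    using q[OF that(1)] that by (auto simp: Q_def)
  have q2: "(\<Sum>j<k. q a j) \<le> real k * ((\<Sum>v\<in>W a. g v) / real (card (W a)))" if "a < k" for a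
    using q[OF that] by (auto simp: Q_def)
  \<comment> \<open>The cyclic orders form a Latin square: \<open>P c j\<close> is a bijection in
    \<open>j\<close> for fixed \<open>c\<close>, so each order visits every part, and in
    \<open>c\<close> for fixed \<open>j\<close>, so averaging over \<open>c\<close> puts every part
    in every position.\<close>
  define P where "P c j = (c + j) mod k" for c j :: nat
  have P: "bij_betw (P c) {..<k} {..<k}" for c
    unfolding P_def by (rule bij_betw_add_mod)
  have P': "bij_betw (\<lambda>c. P c j) {..<k} {..<k}" for j
    unfolding P_def using bij_betw_add_mod[of j k] by (simp add: add.commute)
  have Pk: "P c j < k" for c j using k by (simp add: P_def)
  have chain: "\<exists>u. u ` P c ` {..<j} \<in> J \<and> (\<forall>l<j. u (P c l) \<in> W (P c l)) \<and>
      (\<Sum>l<j. g (u (P c l))) \<le> (\<Sum>l<j. q (P c l) l)" if "j \<le> k" for c j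
    using that
  proof (induction j)
    case 0
    then show ?case using empty by simp
  next
    case (Suc j)
    then obtain u where u: "u ` P c ` {..<j} \<in> J" "\<And>l. l < j \<Longrightarrow> u (P c l) \<in> W (P c l)"
      "(\<Sum>l<j. g (u (P c l))) \<le> (\<Sum>l<j. q (P c l) l)" by auto
    define e where "e = u ` P c ` {..<j}"
    have Pne: "P c l \<noteq> P c l'" if "l < k" "l' < k" "l \<noteq> l'" for l l'
      using P[of c] that by (auto simp: bij_betw_def inj_on_def)
    have "inj_on (\<lambda>l. u (P c l)) {..<j}"
    proof (rule inj_onI, rule ccontr)
      fix x y assume xy: "x \<in> {..<j}" "y \<in> {..<j}" "u (P c x) = u (P c y)" "x \<noteq> y"
      then have "P c x \<noteq> P c y" using Pne Suc.prems by simp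
      then show False using disj[OF Pk Pk, of c x c y] u(2)[of x] u(2)[of y] xy by auto
    qed
    then have ce: "card e = j" unfolding e_def image_image by (simp add: card_image)
    have "e \<inter> W (P c j) = {}"
    proof -
      have "u (P c l) \<notin> W (P c j)" if "l < j" for l
        using disj[OF Pk Pk, of c l c j] Pne[of l j] u(2)[OF that] that Suc.prems by auto
      then show ?thesis by (auto simp: e_def)
    qed
    moreover have "e \<subseteq> (\<Union>b<k. W b)" using u(2) Pk by (auto simp: e_def)
    ultimately have "(k - j) * card (W (P c j)) \<le> k * card {v \<in> W (P c j). insert v e \<in> J}"
      using ext[of e "P c j"] u(1) ce Suc.prems Pk by (simp add: e_def)
    then obtain v where v: "v \<in> W (P c j)" "insert v e \<in> J" "g v \<le> q (P c j) j"
      using q1[OF Pk, of j "{v \<in> W (P c j). insert v e \<in> J}" c j] Suc.prems by auto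
    define u' where "u' = u(P c j := v)"
    have same: "u' (P c l) = u (P c l)" if "l < j" for l
      using Pne[of l j] that Suc.prems by (auto simp: u'_def)
    have "u' ` P c ` {..<Suc j} = insert v e"
      using same by (force simp: lessThan_Suc e_def u'_def image_iff)
    then show ?case
      using v u(2,3) same by (intro exI[of _ u']) (auto simp: less_Suc_eq u'_def intro: add_mono)
  qed
  have "(\<Sum>c<k. \<Sum>l<k. q (P c l) l) = (\<Sum>l<k. \<Sum>c<k. q (P c l) l)" by (rule sum.swap)
  also have "\<dots> = (\<Sum>l<k. \<Sum>a<k. q a l)"
    by (intro sum.cong refl sum.reindex_bij_betw[OF P'])
  also have "\<dots> = (\<Sum>a<k. \<Sum>l<k. q a l)" by (rule sum.swap)
  also have "\<dots> \<le> (\<Sum>a<k. real k * ((\<Sum>v\<in>W a. g v) / real (card (W a))))"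
    by (intro sum_mono q2) simp
  also have "\<dots> = (\<Sum>c<k. \<Sum>a<k. (\<Sum>v\<in>W a. g v) / real (card (W a)))"
    by (simp add: sum_distrib_left)
  finally have le: "(\<Sum>c<k. \<Sum>l<k. q (P c l) l) \<le> (\<Sum>c<k. \<Sum>a<k. (\<Sum>v\<in>W a. g v) / real (card (W a)))" .
  have "\<exists>c. (\<Sum>l<k. q (P c l) l) \<le> (\<Sum>a<k. (\<Sum>v\<in>W a. g v) / real (card (W a)))"
  proof (rule ccontr)
    assume *: "\<not> ?thesis"
    have "(\<Sum>c<k. \<Sum>a<k. (\<Sum>v\<in>W a. g v) / real (card (W a))) < (\<Sum>c<k. \<Sum>l<k. q (P c l) l)"
    proof (rule sum_strict_mono)
      show "(\<Sum>a<k. (\<Sum>v\<in>W a. g v) / real (card (W a))) < (\<Sum>l<k. q (P c l) l)" for c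
        using * unfolding not_ex not_le by blast
    qed (use k in auto)
    with le show False by linarith
  qed
  then obtain c where c: "(\<Sum>l<k. q (P c l) l) \<le> (\<Sum>a<k. (\<Sum>v\<in>W a. g v) / real (card (W a)))" ..
  obtain u where u: "u ` P c ` {..<k} \<in> J" "\<And>l. l < k \<Longrightarrow> u (P c l) \<in> W (P c l)"
    "(\<Sum>l<k. g (u (P c l))) \<le> (\<Sum>l<k. q (P c l) l)" using chain[of k c] by auto
  have im: "P c ` {..<k} = {..<k}" using P[of c] by (simp add: bij_betw_def)
  show thesis
  proof (rule that[of u])
    show "u ` {..<k} \<in> J" using u(1) im by simp
    show "u a \<in> W a" if "a < k" for a
      using u(2) im that by (metis imageE lessThan_iff)
    have "(\<Sum>l<k. g (u (P c l))) = (\<Sum>a<k. g (u a))"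
      by (rule sum.reindex_bij_betw[OF P])
    then show "(\<Sum>a<k. g (u a)) \<le> (\<Sum>a<k. (\<Sum>v\<in>W a. g v) / real (card (W a)))"
      using u(3) c by linarith
  qed
qed

text \<open>For negative \<open>x = - y\<close> the bound follows from
  \<open>1 + y \<le> exp y\<close> and \<open>(1 + y) * (1 - y + y^2) = 1 + y^3\<close>. The linear
  term is kept exactly, since it is what the choice of a light edge controls.\<close>

lemma exp_le_quadratic:
  fixes x :: real
  assumes "\<bar>x\<bar> \<le> 1"
  shows "exp x \<le> 1 + x + x\<^sup>2"
proof (cases "0 \<le> x")
  case True
  then show ?thesis using exp_bound assms by simp
next
  case False
  define y where "y = - x"
  have y: "0 < y" using False by (simp add: y_def)
  have "1 \<le> (1 + y) * (1 - y + y\<^sup>2)"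
  proof -
    have "(1 + y) * (1 - y + y\<^sup>2) = 1 + y ^ 3" by (simp add: algebra_simps power2_eq_square power3_eq_cube)
    then show ?thesis using y by simp
  qed
  also have "\<dots> \<le> exp y * (1 - y + y\<^sup>2)"
  proof (rule mult_right_mono)
    show "1 + y \<le> exp y" by (rule exp_ge_add_one_self)
    have "1 - y + y\<^sup>2 = (y - 1/2)\<^sup>2 + 3/4" by (simp add: power2_eq_square algebra_simps)
    then show "0 \<le> 1 - y + y\<^sup>2" by simp
  qed
  finally have "exp (-y) \<le> 1 - y + y\<^sup>2" by (simp add: exp_minus field_simps)
  then show ?thesis by (simp add: y_def)
qed

section \<open>The potential\<close>

text \<open>\<open>s\<close> is the room above the density \<open>(k - card e) / k\<close> that
  \<open>light_edge\<close> requires; it is consumed as the relative degrees drift. The empty edge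
  is handled by \<open>singleton_edge\<close> and so never drifts. Edges of any size are allowed and
  may meet a part repeatedly, as happens in the padded system.\<close>

locale slack_partite_system =
  fixes V :: "nat \<Rightarrow> 'a set" and J :: "'a set set" and k r n :: nat and s :: real
  assumes k_pos: "0 < k" and k_le: "k \<le> r" and n_pos: "0 < n"
    and finite_part: "\<And>i. i < r \<Longrightarrow> finite (V i)"
    and card_part: "\<And>i. i < r \<Longrightarrow> card (V i) = n"
    and disjoint_parts: "\<And>i j. i < r \<Longrightarrow> j < r \<Longrightarrow> i \<noteq> j \<Longrightarrow> V i \<inter> V j = {}"
    and empty_edge: "{} \<in> J"
    and edge_subset: "\<And>e. e \<in> J \<Longrightarrow> e \<subseteq> (\<Union>i<r. V i)"
    and singleton_edge: "\<And>i v. i < r \<Longrightarrow> v \<in> V i \<Longrightarrow> {v} \<in> J"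
    and degree: "\<And>e i. e \<in> J \<Longrightarrow> 0 < card e \<Longrightarrow> card e < k \<Longrightarrow> i < r \<Longrightarrow> e \<inter> V i = {} \<Longrightarrow>
      (real (k - card e) / real k + s) * real n \<le> real (card {v \<in> V i. insert v e \<in> J})"
begin

definition pairs :: "('a set \<times> nat) set" where
  "pairs = {(e, i). e \<in> J \<and> 0 < card e \<and> card e < k \<and> i < r \<and> e \<inter> V i = {}}"

definition nbr :: "'a set \<times> nat \<Rightarrow> 'a set" where
  "nbr x = {v \<in> V (snd x). insert v (fst x) \<in> J}"

text \<open>The loss of density of a neighbourhood in passing from the full part to the vertices in
  \<open>W\<close>. While it is at most \<open>s\<close>, \<open>degree\<close> still yields the
  density that a light edge requires inside \<open>W\<close>.\<close>

definition defect :: "'a set \<Rightarrow> 'a set \<times> nat \<Rightarrow> real" where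
  "defect W x = real (card (nbr x)) / real n - real (card (nbr x \<inter> W)) / real (card (V (snd x) \<inter> W))"

text \<open>A soft maximum of the defects: all terms are positive, so for \<open>0 < l\<close> the
  bound \<open>potential l W \<le> exp (l * s)\<close> forces every defect to be at most
  \<open>s\<close>.\<close>

definition potential :: "real \<Rightarrow> 'a set \<Rightarrow> real" where
  "potential l W = (\<Sum>x\<in>pairs. exp (l * defect W x))"

lemma finite_vertices: "finite (\<Union>i<r. V i)"
  using finite_part by simp

lemma finite_edge: "e \<in> J \<Longrightarrow> finite e"
  using edge_subset finite_vertices finite_subset by blast

lemma finite_pairs: "finite pairs"
proof (rule finite_subset)
  show "pairs \<subseteq> Pow (\<Union>i<r. V i) \<times> {..<r}" using edge_subset by (auto simp: pairs_def)
qed (use finite_vertices in simp)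

text \<open>Expanding \<open>exp\<close> to second order, the linear part of the change compares the
  weight of the removed edge with the sum of the mean weights of the chosen parts, and a light edge
  makes this nonpositive. Only the quadratic error \<open>(l / m)^2\<close> remains.\<close>

lemma greedy_step:
  assumes l: "0 < l" and pot: "potential l W \<le> exp (l * s)"
    and p: "inj_on p {..<k}" "\<And>a. a < k \<Longrightarrow> p a < r"
    and m: "l \<le> m" "\<And>i. i < r \<Longrightarrow> m + 1 \<le> real (card (V i \<inter> W))"
  obtains u where "u ` {..<k} \<in> J" "\<And>a. a < k \<Longrightarrow> u a \<in> V (p a) \<inter> W"
    "potential l (W - u ` {..<k}) \<le> potential l W * (1 + (l / m)\<^sup>2)"
proof -
  define w where "w i = real (card (V i \<inter> W))" for i
  define E where "E x = exp (l * defect W x)" for x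
  \<comment> \<open>The first-order change of the term of \<open>x\<close> will be
    \<open>l * c x * (b x - h x)\<close>; the weight \<open>g\<close> distributes the
    \<open>b\<close> part of it over the vertices.\<close>
  define c where "c x = E x / (w (snd x) - 1)" for x
  define g where "g v = (\<Sum>x\<in>pairs. c x * of_bool (v \<in> nbr x))" for v
  have m0: "0 < m" using l m by linarith
  have w: "m \<le> w i - 1" "1 < w i" if "i < r" for i
    using m(2)[OF that] m0 by (auto simp: w_def)
  have pairs_r: "snd x < r" if "x \<in> pairs" for x using that by (auto simp: pairs_def)
  have E0: "0 < E x" for x by (simp add: E_def)
  have c0: "0 \<le> c x" if "x \<in> pairs" for x
    using w(2)[OF pairs_r[OF that]] E0[of x] by (simp add: c_def)
  have finVW: "finite (V i \<inter> W)" if "i < r" for i using finite_part[OF that] by simp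
  have pne: "V (p a) \<inter> V (p b) = {}" if "a < k" "b < k" "a \<noteq> b" for a b
    using that p inj_onD[OF p(1), of a b] by (intro disjoint_parts) auto
  have def_le: "defect W x \<le> s" if "x \<in> pairs" for x
  proof -
    have "E x \<le> potential l W"
      unfolding potential_def E_def using that finite_pairs by (intro member_le_sum) auto
    then have "exp (l * defect W x) \<le> exp (l * s)" using pot unfolding E_def by linarith
    then show ?thesis using l by simp
  qed
  have ext: "(k - card e) * card (V (p a) \<inter> W) \<le> k * card {v \<in> V (p a) \<inter> W. insert v e \<in> J}"
    if e: "e \<in> J" "e \<subseteq> (\<Union>b<k. V (p b) \<inter> W)" "card e < k" "a < k" "e \<inter> (V (p a) \<inter> W) = {}" for e a
  proof (cases "card e = 0")
    case True
    then have "e = {}" using finite_edge e(1) by simp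
    moreover have "{v \<in> V (p a) \<inter> W. insert v {} \<in> J} = V (p a) \<inter> W"
      using singleton_edge p(2)[OF e(4)] by auto
    ultimately show ?thesis by simp
  next
    case False
    have "e \<inter> V (p a) = {}" using e by blast
    then have x: "(e, p a) \<in> pairs" using e False p by (auto simp: pairs_def)
    let ?d = "real (card (nbr (e, p a) \<inter> W))"
    have wp: "1 < w (p a)" using w p e by blast
    \<comment> \<open>The slack \<open>s\<close> in \<open>degree\<close> pays exactly for a defect
      of at most \<open>s\<close>, leaving density \<open>(k - card e) / k\<close> in
      \<open>W\<close>.\<close>
    have "(real (k - card e) / real k + s) * real n \<le> real (card (nbr (e, p a)))"
      using degree[of e "p a"] e False p \<open>e \<inter> V (p a) = {}\<close> by (simp add: nbr_def)
    then have "real (k - card e) / real k + s \<le> real (card (nbr (e, p a))) / real n"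
      using n_pos by (simp add: field_simps)
    also have "\<dots> \<le> s + ?d / w (p a)" using def_le[OF x] by (simp add: defect_def w_def)
    finally have "real (k - card e) * w (p a) \<le> real k * ?d"
      using wp k_pos by (simp add: field_simps)
    moreover have "nbr (e, p a) \<inter> W = {v \<in> V (p a) \<inter> W. insert v e \<in> J}" by (auto simp: nbr_def)
    ultimately have "real ((k - card e) * card (V (p a) \<inter> W)) \<le> real (k * card {v \<in> V (p a) \<inter> W. insert v e \<in> J})"
      by (simp add: w_def)
    then show ?thesis by (simp only: of_nat_le_iff)
  qed
  obtain u where u: "u ` {..<k} \<in> J" "\<And>a. a < k \<Longrightarrow> u a \<in> V (p a) \<inter> W"
    and ug: "(\<Sum>a<k. g (u a)) \<le> (\<Sum>a<k. (\<Sum>v\<in>V (p a) \<inter> W. g v) / real (card (V (p a) \<inter> W)))"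
  proof (rule light_edge[of k "\<lambda>a. V (p a) \<inter> W" g J])
    show "V (p a) \<inter> W \<noteq> {}" if "a < k" for a
      using w(2)[OF p(2)[OF that]] by (auto simp: w_def)
    show "V (p a) \<inter> W \<inter> (V (p b) \<inter> W) = {}" if "a < k" "b < k" "a \<noteq> b" for a b
      using pne[OF that] by blast
    show "0 \<le> g v" for v unfolding g_def using c0 by (intro sum_nonneg) simp
  qed (use k_pos finVW p empty_edge ext in auto)
  define f where "f = u ` {..<k}"
  \<comment> \<open>For a pair \<open>x\<close>, \<open>b x\<close> tells whether the removed edge
    hits the neighbourhood, and \<open>h x\<close> is the mean of this over a uniform remaining
    vertex of the part \<open>snd x\<close>. Both vanish if that part is not among the chosen
    ones.\<close>
  define b where "b x = (\<Sum>a<k. of_bool (u a \<in> nbr x) :: real)" for x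
  define t where "t x = real (card (nbr x \<inter> W))" for x
  define h where "h x = (\<Sum>a<k. of_bool (p a = snd x) * t x / w (snd x))" for x
  have u_part: "u a \<in> V i \<longleftrightarrow> p a = i" if "a < k" "i < r" for a i
    using u(2)[OF that(1)] disjoint_parts[OF p(2)[OF that(1)] that(2)] by auto
  have change: "defect (W - f) x = defect W x + (b x - h x) / (w (snd x) - 1)"
    and bh: "\<bar>b x - h x\<bar> \<le> 1" if x: "x \<in> pairs" for x
  proof -
    let ?i = "snd x"
    have ir: "?i < r" by (rule pairs_r[OF x])
    have nb: "nbr x \<subseteq> V ?i" by (auto simp: nbr_def)
    have "defect (W - f) x = defect W x + (b x - h x) / (w ?i - 1) \<and> \<bar>b x - h x\<bar> \<le> 1"
    proof (cases "?i \<in> p ` {..<k}")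
      case False
      then have np: "p a \<noteq> ?i" if "a < k" for a using that by force
      have nV: "u a \<notin> V ?i" if "a < k" for a using u_part[OF that ir] np[OF that] by simp
      have "V ?i \<inter> (W - f) = V ?i \<inter> W" using nV by (auto simp: f_def)
      moreover from this have "nbr x \<inter> (W - f) = nbr x \<inter> W" using nb by blast
      moreover have "b x = 0" unfolding b_def using nb nV by (intro sum.neutral) auto
      moreover have "h x = 0" unfolding h_def using np by (intro sum.neutral) auto
      ultimately show ?thesis by (simp add: defect_def)
    next
      case True
      then obtain a where a: "a < k" "p a = ?i" by auto
      have uniq: "p a' = ?i \<longleftrightarrow> a' = a" if "a' < k" for a'
        using p(1) a that by (auto simp: inj_on_def)
      have inV: "u a' \<in> V ?i \<longleftrightarrow> a' = a" if "a' < k" for a'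
        using u_part[OF that ir] uniq[OF that] by simp
      have ua: "u a \<in> V ?i \<inter> W" using u(2)[OF a(1)] a(2) by simp
      have eq1: "V ?i \<inter> (W - f) = V ?i \<inter> W - {u a}" using inV a by (auto simp: f_def)
      have eq2: "nbr x \<inter> (W - f) = nbr x \<inter> W - {u a}" using inV a nb by (auto simp: f_def)
      have "b x = (\<Sum>a'<k. if a' = a then of_bool (u a \<in> nbr x) else 0)"
        unfolding b_def using inV nb by (intro sum.cong) auto
      then have bx: "b x = of_bool (u a \<in> nbr x)" using a by simp
      have "h x = (\<Sum>a'<k. if a' = a then t x / w ?i else 0)"
        unfolding h_def using uniq by (intro sum.cong) auto
      then have hx: "h x = t x / w ?i" using a by simp
      have wi: "1 < w ?i" by (rule w(2)[OF ir])
      have c1: "real (card (V ?i \<inter> (W - f))) = w ?i - 1"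
        unfolding eq1 w_def using ua finVW[OF ir] wi
        by (subst card_Diff_singleton) (auto simp: w_def of_nat_diff)
      have fin: "finite (nbr x \<inter> W)" using nb finVW[OF ir] by (auto intro: finite_subset[of _ "V ?i \<inter> W"])
      have c2: "real (card (nbr x \<inter> (W - f))) = t x - b x"
      proof (cases "u a \<in> nbr x")
        case True
        then have "card (nbr x \<inter> W) > 0" using ua fin by (auto simp: card_gt_0_iff)
        then show ?thesis
          unfolding eq2 t_def bx using True ua fin by (simp add: card_Diff_singleton of_nat_diff)
      qed (simp add: eq2 t_def bx)
      have "card (nbr x \<inter> W) \<le> card (V ?i \<inter> W)" using nb finVW[OF ir] by (intro card_mono) auto
      then have tw: "0 \<le> t x / w ?i" "t x / w ?i \<le> 1" using wi by (auto simp: t_def w_def)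
      have "t x / w ?i - (t x - b x) / (w ?i - 1) = (b x - t x / w ?i) / (w ?i - 1)"
        using wi by (simp add: field_simps)
      then have "defect (W - f) x = defect W x + (b x - h x) / (w ?i - 1)"
        unfolding defect_def c1 c2 hx by (simp add: t_def w_def)
      moreover have "\<bar>b x - h x\<bar> \<le> 1" using tw unfolding hx bx by (auto simp: of_bool_def)
      ultimately show ?thesis by blast
    qed
    then show "defect (W - f) x = defect W x + (b x - h x) / (w ?i - 1)" "\<bar>b x - h x\<bar> \<le> 1" by auto
  qed
  have sum_b: "(\<Sum>x\<in>pairs. c x * b x) = (\<Sum>a<k. g (u a))"
    unfolding g_def b_def sum_distrib_left by (rule sum.swap)
  \<comment> \<open>Exchanging sums: over one part, \<open>g\<close> counts each neighbourhood in
    that part by its size in \<open>W\<close>, so the mean weights of the chosen parts add up to the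
    \<open>h\<close> terms.\<close>
  have "(\<Sum>v\<in>V i \<inter> W. g v) = (\<Sum>x\<in>pairs. c x * (of_bool (i = snd x) * t x))" if "i < r" for i
  proof -
    have "(\<Sum>v\<in>V i \<inter> W. of_bool (v \<in> nbr x)) = of_bool (i = snd x) * t x" if "x \<in> pairs" for x
    proof -
      have "V i \<inter> W \<inter> {v. v \<in> nbr x} = (if i = snd x then nbr x \<inter> W else {})"
        using disjoint_parts[OF \<open>i < r\<close> pairs_r[OF that]] by (auto simp: nbr_def)
      then show ?thesis using finVW[OF \<open>i < r\<close>] by (simp add: sum_of_bool_eq t_def)
    qed
    then have "(\<Sum>x\<in>pairs. c x * (\<Sum>v\<in>V i \<inter> W. of_bool (v \<in> nbr x))) = (\<Sum>x\<in>pairs. c x * (of_bool (i = snd x) * t x))"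
      by (intro sum.cong) auto
    then show ?thesis unfolding g_def sum.swap[of _ pairs] by (simp add: sum_distrib_left)
  qed
  then have "(\<Sum>a<k. (\<Sum>v\<in>V (p a) \<inter> W. g v) / w (p a)) =
      (\<Sum>a<k. \<Sum>x\<in>pairs. c x * (of_bool (p a = snd x) * t x / w (snd x)))"
    using p(2) by (intro sum.cong) (auto simp: sum_divide_distrib intro!: sum.cong)
  also have "\<dots> = (\<Sum>x\<in>pairs. c x * h x)"
    unfolding h_def sum_distrib_left by (rule sum.swap)
  finally have linear: "(\<Sum>x\<in>pairs. c x * (b x - h x)) \<le> 0"
    using ug sum_b by (simp add: right_diff_distrib sum_subtractf w_def)
  have "potential l (W - f) \<le> (\<Sum>x\<in>pairs. E x + l * (c x * (b x - h x)) + E x * (l / m)\<^sup>2)"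
    unfolding potential_def
  proof (rule sum_mono)
    fix x assume x: "x \<in> pairs"
    define d where "d = (b x - h x) / (w (snd x) - 1)"
    have wx: "m \<le> w (snd x) - 1" by (rule w(1)[OF pairs_r[OF x]])
    have "\<bar>d\<bar> \<le> 1 / m"
      unfolding d_def abs_divide using bh[OF x] wx m0 by (intro frac_le) auto
    then have ld: "\<bar>l * d\<bar> \<le> l / m" using l mult_left_mono[of "\<bar>d\<bar>" "1 / m" l] by (simp add: abs_mult)
    also have "l / m \<le> 1" using m m0 by simp
    finally have "exp (l * d) \<le> 1 + l * d + (l * d)\<^sup>2" by (rule exp_le_quadratic)
    also have "(l * d)\<^sup>2 \<le> (l / m)\<^sup>2" using ld by (metis abs_ge_zero power2_abs power_mono)
    finally have "E x * exp (l * d) \<le> E x * (1 + l * d + (l / m)\<^sup>2)"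
      using E0[of x] by (intro mult_left_mono) auto
    moreover have "exp (l * defect (W - f) x) = E x * exp (l * d)"
      unfolding change[OF x] E_def d_def by (simp add: distrib_left exp_add)
    moreover have "E x * (l * d) = l * (c x * (b x - h x))" by (simp add: c_def d_def)
    ultimately show "exp (l * defect (W - f) x) \<le> E x + l * (c x * (b x - h x)) + E x * (l / m)\<^sup>2"
      by (simp add: algebra_simps)
  qed
  also have "\<dots> = potential l W + l * (\<Sum>x\<in>pairs. c x * (b x - h x)) + potential l W * (l / m)\<^sup>2"
    by (simp add: sum.distrib potential_def E_def sum_distrib_left sum_distrib_right)
  also have "\<dots> \<le> potential l W * (1 + (l / m)\<^sup>2)"
    using linear l by (simp add: algebra_simps mult_nonneg_nonpos)
  finally show thesis using u that unfolding f_def by blast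
qed

end

section \<open>The greedy matching\<close>

text \<open>
  Round \<open>x\<close> of the greedy procedure uses the parts \<open>x, \<dots>, x + k - 1\<close> modulo \<open>r\<close>, so that all parts
  shrink at the same rate; \<open>turns k r t i\<close> counts the uses of part \<open>i\<close> in the first \<open>t\<close> rounds.
\<close>

definition turns :: "nat \<Rightarrow> nat \<Rightarrow> nat \<Rightarrow> nat \<Rightarrow> nat" where
  "turns k r t i = (\<Sum>x<t. of_bool (\<exists>a<k. (x + a) mod r = i))"

text \<open>Among any \<open>r\<close> consecutive rounds the shift by \<open>a\<close> visits the
  residue \<open>i\<close> exactly once.\<close>

lemma sum_of_bool_mod_block:
  assumes "i < (r::nat)"
  shows "(\<Sum>x<r * q. of_bool ((x + a) mod r = i)) = q"
proof (induction q)
  case (Suc q)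
  have split: "(\<Sum>x<m + r. f x) = (\<Sum>x<m. f x) + (\<Sum>j<r. f (m + j))" for f :: "nat \<Rightarrow> nat" and m
    by (induction r) (auto simp: add.assoc)
  have "(\<Sum>j<r. of_bool ((r * q + j + a) mod r = i)) = (\<Sum>j<r. of_bool ((a + j) mod r = i) :: nat)"
  proof (intro sum.cong refl)
    fix j show "of_bool ((r * q + j + a) mod r = i) = (of_bool ((a + j) mod r = i) :: nat)"
      using mod_mult_self2[of "a + j" r q] by (simp only: ac_simps)
  qed
  also have "\<dots> = (\<Sum>j<r. of_bool (j = i))"
    by (rule sum.reindex_bij_betw[OF bij_betw_add_mod])
  also have "\<dots> = 1" using assms by (simp add: of_bool_def)
  finally show ?case using Suc.IH split[where m = "r * q"] by (simp add: add.commute)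
qed simp

lemma turns_full:
  assumes "k \<le> r" "i < r"
  shows "turns k r (r * q) i = k * q"
proof -
  \<comment> \<open>Since \<open>k \<le> r\<close>, at most one \<open>a\<close> works in a given
    round, so the existential can be counted by a sum.\<close>
  have "of_bool (\<exists>a<k. (x + a) mod r = i) = (\<Sum>a<k. of_bool ((x + a) mod r = i) :: nat)" for x
  proof (cases "\<exists>a<k. (x + a) mod r = i")
    case True
    then obtain a where a: "a < k" "(x + a) mod r = i" by blast
    have "(x + b) mod r = i \<longleftrightarrow> b = a" if "b < k" for b
      using bij_betw_imp_inj_on[OF bij_betw_add_mod[of x r]] a that assms(1)
      by (auto dest: inj_onD[where x = b and y = a])
    then have "(\<Sum>b<k. of_bool ((x + b) mod r = i)) = (\<Sum>b<k. if b = a then 1 else 0 :: nat)"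
      by (intro sum.cong) auto
    then show ?thesis using True a by simp
  qed auto
  then have "turns k r (r * q) i = (\<Sum>x<r * q. \<Sum>a<k. of_bool ((x + a) mod r = i))"
    by (simp add: turns_def)
  also have "\<dots> = (\<Sum>a<k. \<Sum>x<r * q. of_bool ((x + a) mod r = i))" by (rule sum.swap)
  also have "\<dots> = k * q" using sum_of_bool_mod_block[OF assms(2)] by simp
  finally show ?thesis .
qed

lemma turns_mono: "t \<le> t' \<Longrightarrow> turns k r t i \<le> turns k r t' i"
  unfolding turns_def by (rule sum_mono2) auto

context slack_partite_system
begin

text \<open>The invariant carries the exact part sizes, through \<open>turns\<close>, and the growth
  of the potential, which starts at \<open>card pairs\<close> because all defects vanish.
  \<open>start\<close> keeps the potential below \<open>exp (l * s)\<close> through all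
  \<open>r * q\<close> rounds, and \<open>q\<close> keeps at least \<open>m + 1\<close> vertices in
  every part.\<close>

lemma greedy_run:
  assumes l: "0 < l" "l \<le> m"
    and start: "real (card pairs) * exp (real (r * q) * (l / m)\<^sup>2) \<le> exp (l * s)"
    and q: "m + 1 + real (k * q) \<le> real n"
    and t: "t \<le> r * q"
  shows "\<exists>M. M \<subseteq> layer J k \<and> matching M \<and>
    (\<forall>i<r. card (V i \<inter> ((\<Union>i<r. V i) - \<Union>M)) + turns k r t i = n) \<and>
    potential l ((\<Union>i<r. V i) - \<Union>M) \<le> real (card pairs) * (1 + (l / m)\<^sup>2) ^ t"
  using t
proof (induction t)
  case 0
  have VU: "V i \<inter> (\<Union>i<r. V i) = V i" if "i < r" for i using that by blast
  have "defect (\<Union>i<r. V i) x = 0" if "x \<in> pairs" for x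
  proof -
    have x: "snd x < r" using that by (auto simp: pairs_def)
    then have "nbr x \<inter> (\<Union>i<r. V i) = nbr x" by (auto simp: nbr_def)
    then show ?thesis using VU[OF x] card_part[OF x] by (simp add: defect_def)
  qed
  then have "potential l (\<Union>i<r. V i) = real (card pairs)" by (simp add: potential_def)
  then show ?case
    using VU card_part by (intro exI[of _ "{}"]) (auto simp: matching_def turns_def)
next
  case (Suc t)
  then obtain M where M: "M \<subseteq> layer J k" "matching M"
    and cnt: "\<And>i. i < r \<Longrightarrow> card (V i \<inter> ((\<Union>i<r. V i) - \<Union>M)) + turns k r t i = n"
    and pot: "potential l ((\<Union>i<r. V i) - \<Union>M) \<le> real (card pairs) * (1 + (l / m)\<^sup>2) ^ t"
    by auto
  define W where "W = (\<Union>i<r. V i) - \<Union>M"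
  define p where "p a = (t + a) mod r" for a
  have r0: "0 < r" using k_pos k_le by simp
  have inj_p: "inj_on p {..<k}"
    using bij_betw_imp_inj_on[OF bij_betw_add_mod[of t r]] k_le
    unfolding p_def by (auto intro: inj_on_subset)
  have p_r: "p a < r" for a using r0 by (simp add: p_def)
  have big: "m + 1 \<le> real (card (V i \<inter> W))" if i: "i < r" for i
  proof -
    \<comment> \<open>Monotonicity compares with the complete run of \<open>r * q\<close> rounds, in
      which every part is used exactly \<open>k * q\<close> times.\<close>
    have "turns k r t i \<le> k * q"
      using turns_mono[of t "r * q" k r i] turns_full[OF k_le i, of q] Suc.prems by simp
    then have "real n \<le> real (card (V i \<inter> W)) + real (k * q)"
      using cnt[OF i] unfolding W_def by (metis add_le_cancel_left of_nat_add of_nat_mono)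
    then show ?thesis using q by linarith
  qed
  have "(1 + (l / m)\<^sup>2) ^ t \<le> exp ((l / m)\<^sup>2) ^ t"
    by (intro power_mono exp_ge_add_one_self) simp
  also have "\<dots> = exp (real t * (l / m)\<^sup>2)" by (simp add: exp_of_nat_mult)
  also have "\<dots> \<le> exp (real (r * q) * (l / m)\<^sup>2)"
    using Suc.prems unfolding exp_le_cancel_iff by (intro mult_right_mono) (auto simp del: of_nat_mult)
  finally have "real (card pairs) * (1 + (l / m)\<^sup>2) ^ t \<le> exp (l * s)"
    using start mult_left_mono[of _ _ "real (card pairs)"] by (meson of_nat_0_le_iff order_trans)
  then have "potential l W \<le> exp (l * s)" using pot unfolding W_def by linarith
  then obtain u where u: "u ` {..<k} \<in> J" "\<And>a. a < k \<Longrightarrow> u a \<in> V (p a) \<inter> W"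
    and pot_u: "potential l (W - u ` {..<k}) \<le> potential l W * (1 + (l / m)\<^sup>2)"
    using greedy_step[OF l(1) _ inj_p p_r l(2) big] by blast
  define f where "f = u ` {..<k}"
  have u_part: "u a \<in> V i \<longleftrightarrow> p a = i" if "a < k" "i < r" for a i
    using u(2)[OF that(1)] disjoint_parts[OF p_r that(2)] by auto
  have "inj_on u {..<k}"
  proof (rule inj_onI)
    fix a b assume ab: "a \<in> {..<k}" "b \<in> {..<k}" "u a = u b"
    then have "p a = p b" using u_part[of a "p b"] u(2)[of b] p_r by auto
    then show "a = b" using inj_p ab by (auto dest: inj_onD)
  qed
  then have "f \<in> layer J k" using u(1) by (auto simp: layer_def f_def card_image)
  moreover have fW: "f \<subseteq> W" using u(2) by (auto simp: f_def)
  then have "f \<inter> e = {}" if "e \<in> M" for e using that by (auto simp: W_def)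
  then have "matching (insert f M)" using M(2) by (auto simp: matching_def)
  moreover have W': "(\<Union>i<r. V i) - \<Union>(insert f M) = W - f" by (auto simp: W_def)
  moreover have "card (V i \<inter> (W - f)) + turns k r (Suc t) i = n" if i: "i < r" for i
  proof (cases "\<exists>a<k. p a = i")
    case True
    then obtain a where a: "a < k" "p a = i" by blast
    have "p b = i \<longleftrightarrow> b = a" if "b < k" for b
      using inj_p that a by (auto simp: inj_on_def)
    then have "u b \<in> V i \<longleftrightarrow> b = a" if "b < k" for b
      using u_part[OF that i] that by simp
    then have "V i \<inter> (W - f) = V i \<inter> W - {u a}"
      using a by (auto simp: f_def)
    moreover have "u a \<in> V i \<inter> W" using u(2)[of a] a by simp
    ultimately have "Suc (card (V i \<inter> (W - f))) = card (V i \<inter> W)"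
      using card_Suc_Diff1[of "V i \<inter> W" "u a"] finite_part[OF i] by simp
    moreover have "turns k r (Suc t) i = Suc (turns k r t i)" using True by (simp add: turns_def p_def)
    ultimately show ?thesis using cnt[OF i] by (simp add: W_def)
  next
    case False
    then have "V i \<inter> (W - f) = V i \<inter> W" using u_part[OF _ i] by (auto simp: f_def)
    moreover have "turns k r (Suc t) i = turns k r t i" using False by (auto simp: turns_def p_def)
    ultimately show ?thesis using cnt[OF i] by (simp add: W_def)
  qed
  moreover have "potential l (W - f) \<le> real (card pairs) * (1 + (l / m)\<^sup>2) ^ Suc t"
  proof -
    have "potential l W * (1 + (l / m)\<^sup>2) \<le> real (card pairs) * (1 + (l / m)\<^sup>2) ^ t * (1 + (l / m)\<^sup>2)"
      using pot unfolding W_def by (intro mult_right_mono) auto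
    from order_trans[OF pot_u this] show ?thesis unfolding f_def by (simp add: mult_ac)
  qed
  ultimately show ?case using M(1) W' by (intro exI[of _ "insert f M"]) auto
qed

section \<open>Polynomial against exponential growth, and the choice of parameters\<close>

text \<open>Any polynomial bound in \<open>n\<close> suffices, since the budget
  \<open>exp (l * s)\<close> will be exponential in \<open>n\<close>.\<close>

lemma card_pairs_le: "card pairs \<le> k * (r * n + 1) ^ k * r"
proof -
  define U where "U = (\<Union>i<r. V i)"
  have finU: "finite U" using finite_vertices by (simp add: U_def)
  have "card U \<le> (\<Sum>i<r. card (V i))" unfolding U_def by (rule card_UN_le) simp
  also have "\<dots> = r * n" using card_part by simp
  finally have cU: "card U \<le> r * n" .
  define F where "F j = {e. e \<subseteq> U \<and> card e = j}" for j
  have cF: "card (F j) \<le> (r * n + 1) ^ k" if "j < k" for j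
  proof -
    have "card (F j) = card U choose j" unfolding F_def by (rule n_subsets[OF finU])
    also have "\<dots> \<le> (card U) ^ j"
      by (cases "j \<le> card U") (auto simp: binomial_le_pow binomial_eq_0)
    also have "\<dots> \<le> (r * n + 1) ^ j" using cU by (intro power_mono) auto
    also have "\<dots> \<le> (r * n + 1) ^ k" using that by (intro power_increasing) auto
    finally show ?thesis .
  qed
  have finF: "finite (F j)" for j using finU by (auto simp: F_def)
  have "pairs \<subseteq> (\<Union>j<k. F j) \<times> {..<r}"
    using edge_subset by (auto simp: pairs_def F_def U_def)
  then have "card pairs \<le> card ((\<Union>j<k. F j) \<times> {..<r})"
    using finF by (intro card_mono) auto
  also have "\<dots> = card (\<Union>j<k. F j) * r" by (simp add: card_cartesian_product)
  also have "\<dots> \<le> (\<Sum>j<k. card (F j)) * r" by (intro mult_right_mono card_UN_le) auto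
  also have "\<dots> \<le> (\<Sum>j<k. (r * n + 1) ^ k) * r" using cF by (intro mult_right_mono sum_mono) auto
  finally show ?thesis by simp
qed

end

lemma eventually_poly_le_exp:
  fixes c C :: real
  assumes "0 < c"
  shows "\<forall>\<^sub>F n in sequentially. C * real ((r * n + 1) ^ k) \<le> exp (c * real n)"
proof -
  \<comment> \<open>\<open>B\<close> collects the constants once
    \<open>r * n + 1 \<le> (r + 1) * n\<close> is rewritten as a multiple of \<open>c * n\<close>;
    the added \<open>1\<close> makes it positive.\<close>
  define B where "B = (\<bar>C\<bar> + 1) * (real (r + 1) / c) ^ k"
  have B: "0 < B" using assms by (simp add: B_def add_nonneg_pos)
  have "filterlim (\<lambda>n. c * real n) at_top sequentially"
    using assms by (intro filterlim_tendsto_pos_mult_at_top[OF tendsto_const] filterlim_real_sequentially)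
  then have "((\<lambda>n. (c * real n) ^ k / exp (c * real n)) \<longlongrightarrow> 0) sequentially"
    by (rule filterlim_compose[OF tendsto_power_div_exp_0])
  then have "\<forall>\<^sub>F n in sequentially. (c * real n) ^ k / exp (c * real n) < 1 / B"
    using B by (intro order_tendstoD) auto
  then show ?thesis
    using eventually_ge_at_top[of "1::nat"]
  proof eventually_elim
    case (elim n)
    have "r * n + 1 \<le> (r + 1) * n" using elim by simp
    then have "real ((r * n + 1) ^ k) \<le> real (((r + 1) * n) ^ k)"
      by (intro of_nat_mono power_mono) auto
    also have "\<dots> = (real (r + 1) / c * (c * real n)) ^ k"
    proof -
      have "real ((r + 1) * n) = real (r + 1) / c * (c * real n)" using assms by (simp add: field_simps)
      then show ?thesis by (simp only: of_nat_power)
    qed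
    also have "\<dots> = (real (r + 1) / c) ^ k * (c * real n) ^ k" by (rule power_mult_distrib)
    finally have *: "real ((r * n + 1) ^ k) \<le> (real (r + 1) / c) ^ k * (c * real n) ^ k" .
    have "C * real ((r * n + 1) ^ k) \<le> (\<bar>C\<bar> + 1) * real ((r * n + 1) ^ k)"
      by (intro mult_right_mono) auto
    also have "\<dots> \<le> (\<bar>C\<bar> + 1) * ((real (r + 1) / c) ^ k * (c * real n) ^ k)"
      using * by (intro mult_left_mono) auto
    also have "\<dots> = B * (c * real n) ^ k" by (simp add: B_def)
    also have "\<dots> \<le> exp (c * real n)" using elim(1) B by (simp add: field_simps)
    finally show ?case .
  qed
qed

text \<open>Both \<open>l\<close> and \<open>m\<close> are taken linear in \<open>n\<close>, so
  \<open>l / m\<close> is constant and the growth over all rounds uses up half of the exponent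
  \<open>l * s\<close>. The other half covers the polynomial number of pairs.\<close>

theorem almost_perfect_matching:
  fixes s \<gamma> :: real
  assumes s: "0 < s" "s \<le> 1" and g: "0 < \<gamma>" "\<gamma> \<le> 1" and k: "0 < k" "k \<le> r"
  shows "\<forall>\<^sub>F n in sequentially. \<forall>(V :: nat \<Rightarrow> 'a set) J. slack_partite_system V J k r n s \<longrightarrow>
    (\<exists>M. M \<subseteq> layer J k \<and> matching M \<and>
      real (card ((\<Union>i<r. V i) - \<Union>M)) \<le> real r * (\<gamma> * real n + real k))"
proof -
  \<comment> \<open>The solution of \<open>r * n * (l / m)^2 = l * s / 2\<close> for
    \<open>l = \<mu> * n\<close> and \<open>m = \<gamma> * n / 2\<close>.\<close>
  define \<mu> where "\<mu> = s * \<gamma>\<^sup>2 / (8 * real r)"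
  have r0: "0 < r" using k by simp
  have mu: "0 < \<mu>" using s g r0 by (simp add: \<mu>_def)
  have "s * \<gamma>\<^sup>2 \<le> 1 * \<gamma>"
    using s g by (intro mult_mono) (auto simp: power2_eq_square mult_left_le_one_le)
  then have "\<mu> \<le> \<gamma> / (8 * real r)" unfolding \<mu>_def by (intro divide_right_mono) auto
  also have "\<dots> \<le> \<gamma> / 2" using r0 g by (intro divide_left_mono) auto
  finally have mu_le: "\<mu> \<le> \<gamma> / 2" .
  have "\<forall>\<^sub>F n in sequentially. real k * real r * real ((r * n + 1) ^ k) \<le> exp (\<mu> * s / 2 * real n)"
    using mu s by (intro eventually_poly_le_exp) auto
  \<comment> \<open>This gives \<open>1 \<le> m\<close>, so
    \<open>m + 1 \<le> 2 * m = \<gamma> * n\<close>, the share of each part that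
    \<open>k * q\<close> leaves.\<close>
  moreover have "\<forall>\<^sub>F n in sequentially. 2 / \<gamma> \<le> real n"
    using filterlim_real_sequentially by (auto simp: filterlim_at_top)
  ultimately show ?thesis
  proof eventually_elim
    case (elim n)
    show ?case
    proof (intro allI impI)
      fix V :: "nat \<Rightarrow> 'a set" and J assume "slack_partite_system V J k r n s"
      then interpret slack_partite_system V J k r n s .
      define l where "l = \<mu> * real n"
      define m where "m = \<gamma> * real n / 2"
      define q where "q = nat \<lfloor>(1 - \<gamma>) * real n / real k\<rfloor>"
      have n: "0 < real n" using n_pos by simp
      have "real q \<le> (1 - \<gamma>) * real n / real k"
        using g unfolding q_def by (subst of_nat_nat) auto
      then have kq: "real (k * q) \<le> (1 - \<gamma>) * real n" using k by (simp add: field_simps)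
      have "(1 - \<gamma>) * real n / real k \<le> real q + 1"
        unfolding q_def by linarith
      then have kq': "(1 - \<gamma>) * real n \<le> real (k * q) + real k" using k by (simp add: field_simps)
      have l0: "0 < l" using mu n by (simp add: l_def)
      have m0: "0 < m" using g n by (simp add: m_def)
      have lm: "l \<le> m" using mult_right_mono[OF mu_le, of "real n"] by (simp add: l_def m_def)
      have qn: "real q \<le> real n"
      proof -
        have "q \<le> k * q" using k by simp
        then have "real q \<le> real (k * q)" by (simp only: of_nat_le_iff)
        also have "\<dots> \<le> 1 * real n" using kq g by (intro order_trans[OF kq] mult_right_mono) auto
        finally show ?thesis by simp
      qed
      have lm2: "real r * real n * (l / m)\<^sup>2 = l * s / 2"
      proof -
        have lm': "l / m = s * \<gamma> / (4 * real r)"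
          using n g r0 unfolding l_def m_def \<mu>_def by (simp add: field_simps power2_eq_square)
        show ?thesis unfolding lm' unfolding l_def \<mu>_def using r0 by (simp add: field_simps power2_eq_square)
      qed
      have "real (r * q) * (l / m)\<^sup>2 \<le> real r * real n * (l / m)\<^sup>2"
        using qn by (intro mult_right_mono) (auto intro: mult_left_mono)
      then have "exp (real (r * q) * (l / m)\<^sup>2) \<le> exp (l * s / 2)" using lm2 by simp
      moreover have "real (card pairs) \<le> exp (l * s / 2)"
      proof -
        have "real (card pairs) \<le> real (k * (r * n + 1) ^ k * r)"
          using card_pairs_le by (simp only: of_nat_le_iff)
        also have "\<dots> = real k * real r * real ((r * n + 1) ^ k)" by simp
        also have "\<dots> \<le> exp (l * s / 2)" using elim(1) by (simp add: l_def mult_ac)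
        finally show ?thesis .
      qed
      ultimately have "real (card pairs) * exp (real (r * q) * (l / m)\<^sup>2) \<le> exp (l * s / 2) * exp (l * s / 2)"
        by (intro mult_mono) auto
      also have "\<dots> = exp (l * s)" by (simp flip: exp_add)
      finally have start: "real (card pairs) * exp (real (r * q) * (l / m)\<^sup>2) \<le> exp (l * s)" .
      have "1 \<le> m" using elim(2) g by (simp add: m_def field_simps)
      then have "m + 1 + real (k * q) \<le> real n"
        using kq by (simp add: m_def algebra_simps)
      from greedy_run[OF l0 lm start this order_refl]
      obtain M where M: "M \<subseteq> layer J k" "matching M"
        and cnt: "\<And>i. i < r \<Longrightarrow> card (V i \<inter> ((\<Union>i<r. V i) - \<Union>M)) + k * q = n"
        using turns_full[OF k_le] by auto
      have "(\<Union>i<r. V i) - \<Union>M = (\<Union>i<r. V i \<inter> ((\<Union>i<r. V i) - \<Union>M))" by blast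
      then have "card ((\<Union>i<r. V i) - \<Union>M) \<le> (\<Sum>i<r. card (V i \<inter> ((\<Union>i<r. V i) - \<Union>M)))"
        by (metis card_UN_le finite_lessThan)
      also have "\<dots> = (\<Sum>i<r. n - k * q)"
        by (intro sum.cong refl) (metis cnt add_diff_cancel_right' lessThan_iff)
      also have "\<dots> = r * (n - k * q)" by simp
      finally have "card ((\<Union>i<r. V i) - \<Union>M) \<le> r * (n - k * q)" .
      then have "real (card ((\<Union>i<r. V i) - \<Union>M)) \<le> real r * real (n - k * q)"
        by (metis of_nat_le_iff of_nat_mult)
      also have "\<dots> \<le> real r * (\<gamma> * real n + real k)"
      proof (rule mult_left_mono)
        have "k * q \<le> n" using cnt[OF r0] by simp
        then show "real (n - k * q) \<le> \<gamma> * real n + real k"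
          using kq' by (simp add: of_nat_diff algebra_simps)
      qed simp
      finally show "\<exists>M. M \<subseteq> layer J k \<and> matching M \<and>
          real (card ((\<Union>i<r. V i) - \<Union>M)) \<le> real r * (\<gamma> * real n + real k)"
        using M by blast
    qed
  qed
qed

section \<open>Padding\<close>

lemma partite_min_degreeD:
  assumes "ereal c \<le> partite_min_degree V r J j" "e \<in> layer J j" "i < r" "e \<inter> V i = {}"
  shows "c \<le> real (card {v \<in> V i. insert v e \<in> J})"
  using assms by (simp add: partite_min_degree_def le_INF_iff)

text \<open>Choosing a point of \<open>F\<close> in each edge is injective, because distinct edges
  are disjoint.\<close>

lemma card_matching_meeting_le:
  assumes "matching B" "finite F" "\<And>e. e \<in> B \<Longrightarrow> e \<inter> F \<noteq> {}"
  shows "card B \<le> card F"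
proof -
  define \<phi> where "\<phi> e = (SOME x. x \<in> e \<inter> F)" for e
  have \<phi>: "\<phi> e \<in> e \<inter> F" if "e \<in> B" for e
    unfolding \<phi>_def using assms(3)[OF that] by (metis some_in_eq)
  have "inj_on \<phi> B"
  proof (rule inj_onI)
    fix e f assume ef: "e \<in> B" "f \<in> B" "\<phi> e = \<phi> f"
    then have "e \<inter> f \<noteq> {}" using \<phi>[of e] \<phi>[of f] by auto
    then show "e = f" using assms(1) ef by (auto simp: matching_def)
  qed
  then show ?thesis using assms(2) \<phi> by (intro card_inj_on_le[of \<phi>]) auto
qed

definition padded_part :: "nat \<Rightarrow> (nat \<Rightarrow> 'a set) \<Rightarrow> nat \<Rightarrow> ('a + nat \<times> nat) set" where
  "padded_part a V i = Inl ` V i \<union> Inr ` ({i} \<times> {..<a})"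

text \<open>Membership depends only on the original vertices of a set, so padding vertices extend
  every edge. Members may have more than \<open>k\<close> vertices; size \<open>k\<close> is
  selected later by \<open>layer\<close>.\<close>

definition padded_system :: "nat \<Rightarrow> (nat \<Rightarrow> 'a set) \<Rightarrow> nat \<Rightarrow> 'a set set \<Rightarrow> ('a + nat \<times> nat) set set" where
  "padded_system a V r J = {e. e \<subseteq> (\<Union>i<r. padded_part a V i) \<and> Inl -` e \<in> J}"

lemma card_padded_part:
  assumes "finite A"
  shows "card (Inl ` A \<union> Inr ` ({i::nat} \<times> {..<a::nat}) :: ('a + nat \<times> nat) set) = card A + a"
  using assms by (subst card_Un_disjoint) (auto simp: card_image card_cartesian_product)

text \<open>The \<open>a\<close> universal neighbours exceed the at most
  \<open>(1 - 1 / k) * a\<close> that the enlarged part demands, a gain of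
  \<open>a / k \<ge> 2 * \<alpha> * n\<close>. One \<open>\<alpha> * n\<close> repays the loss in
  \<open>d\<close>; the other covers the slack \<open>\<alpha> / 2 * (n + a)\<close>, as
  \<open>a \<le> n\<close>.\<close>

lemma padded_slack_system:
  fixes \<alpha> :: real
  assumes k: "0 < k" "k \<le> r"
    and V: "equi_partition V r n"
    and J: "k_system k (vertex_set V r) J"
    and d0: "ereal (real n) \<le> partite_min_degree V r J 0"
    and d: "\<And>j. 1 \<le> j \<Longrightarrow> j \<le> k - 1 \<Longrightarrow>
      ereal ((real (k - j) / real k - \<alpha>) * real n) \<le> partite_min_degree V r J j"
    and \<alpha>: "0 < \<alpha>" "\<alpha> \<le> 1 / (4 * real k)"
    and a: "2 * real k * \<alpha> * real n \<le> real a" "a \<le> n" and n: "0 < n"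
  shows "slack_partite_system (padded_part a V) (padded_system a V r J) k r (n + a) (\<alpha> / 2)"
proof
  have fin: "finite (V i)" "card (V i) = n" if "i < r" for i
    using V that by (auto simp: equi_partition_def)
  have dis: "V i \<inter> V j = {}" if "i < r" "j < r" "i \<noteq> j" for i j
    using V that by (auto simp: equi_partition_def)
  have J0: "{} \<in> J" and J1: "\<And>e. e \<in> J \<Longrightarrow> e \<subseteq> vertex_set V r \<and> finite e"
    using J by (auto simp: k_system_def)
  have sing: "{v} \<in> J" if "i < r" "v \<in> V i" for i v
  proof -
    have "real n \<le> real (card {v \<in> V i. insert v {} \<in> J})"
      using that J0 by (intro partite_min_degreeD[OF d0]) (auto simp: layer_def)
    then have "{v \<in> V i. {v} \<in> J} = V i"
      using fin[OF that(1)] by (intro card_subset_eq) (auto intro!: antisym card_mono)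
    then show ?thesis using that by blast
  qed
  show "0 < k" "k \<le> r" "0 < n + a" using k n by auto
  show "finite (padded_part a V i)" if "i < r" for i using fin[OF that] by (simp add: padded_part_def)
  show "card (padded_part a V i) = n + a" if "i < r" for i
    unfolding padded_part_def card_padded_part[OF fin(1)[OF that]] by (simp add: fin[OF that])
  show "padded_part a V i \<inter> padded_part a V j = {}" if "i < r" "j < r" "i \<noteq> j" for i j
    using dis[OF that] that by (auto simp: padded_part_def)
  show "{} \<in> padded_system a V r J" using J0 by (simp add: padded_system_def)
  show "e \<subseteq> (\<Union>i<r. padded_part a V i)" if "e \<in> padded_system a V r J" for e
    using that by (simp add: padded_system_def)
  show "{v} \<in> padded_system a V r J" if "i < r" "v \<in> padded_part a V i" for i v
  proof (cases v)
    case (Inl x)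
    then have "Inl -` {v} = {x}" by auto
    moreover have "x \<in> V i" using that Inl by (auto simp: padded_part_def)
    ultimately show ?thesis using sing[of i x] that by (auto simp: padded_system_def)
  next
    case (Inr y)
    then have "Inl -` {v} = {}" by auto
    then show ?thesis using J0 that by (auto simp: padded_system_def)
  qed
  show "(real (k - card e) / real k + \<alpha> / 2) * real (n + a)
      \<le> real (card {v \<in> padded_part a V i. insert v e \<in> padded_system a V r J})"
    if e: "e \<in> padded_system a V r J" "0 < card e" "card e < k" "i < r" "e \<inter> padded_part a V i = {}" for e i
  proof -
    \<comment> \<open>The original degree conditions apply to the trace \<open>e0\<close>, which may
      be smaller than \<open>e\<close>; the threshold decreases with the size of the edge, so this
      only helps.\<close>
    define e0 where "e0 = Inl -` e"
    define D where "D = {v \<in> V i. insert v e0 \<in> J}"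
    have e0J: "e0 \<in> J" using e by (simp add: e0_def padded_system_def)
    have fe: "finite e" using e(2) by (simp add: card_gt_0_iff)
    have "card e0 = card (Inl ` e0 :: ('a + nat \<times> nat) set)" by (simp add: card_image)
    also have "\<dots> \<le> card e" using fe by (intro card_mono) (auto simp: e0_def)
    finally have c0: "card e0 \<le> card e" .
    have disj0: "e0 \<inter> V i = {}" using e(5) by (auto simp: e0_def padded_part_def)
    have vim: "Inl -` insert (Inl v) e = insert v e0" "Inl -` insert (Inr y) e = e0" for v y
      by (auto simp: e0_def)
    have "Inl ` D \<union> Inr ` ({i} \<times> {..<a}) \<subseteq> {v \<in> padded_part a V i. insert v e \<in> padded_system a V r J}"
      using e vim e0J by (auto simp: D_def padded_system_def padded_part_def)
    moreover have "finite {v \<in> padded_part a V i. insert v e \<in> padded_system a V r J}"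
      using fin[OF e(4)] by (simp add: padded_part_def)
    ultimately have "card (Inl ` D \<union> Inr ` ({i} \<times> {..<a})) \<le> card {v \<in> padded_part a V i. insert v e \<in> padded_system a V r J}"
      by (rule card_mono[rotated])
    moreover have finD: "finite D" using fin[OF e(4)] by (simp add: D_def)
    ultimately have low: "card D + a \<le> card {v \<in> padded_part a V i. insert v e \<in> padded_system a V r J}"
      unfolding card_padded_part[OF finD] by simp
    define x where "x = real (k - card e) / real k"
    have x1: "x \<le> 1 - 1 / real k" using e(2,3) k by (simp add: x_def field_simps of_nat_diff)
    have x0: "0 \<le> x" by (simp add: x_def)
    have k1: "0 < real k" using k by simp
    have "(x + \<alpha> / 2) * (real n + real a) \<le> real (card D) + real a"
    proof (cases "card e0 = 0")
      \<comment> \<open>An edge consisting of padding only is extended by the whole padded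
        part.\<close>
      case True
      then have "e0 = {}" using J1[OF e0J] by simp
      then have "D = V i" using sing[OF e(4)] by (auto simp: D_def)
      moreover have "\<alpha> / 2 \<le> 1 / real k" using \<alpha> k1 by (simp add: field_simps)
      then have "x + \<alpha> / 2 \<le> 1" using x1 by linarith
      then have "(x + \<alpha> / 2) * (real n + real a) \<le> 1 * (real n + real a)" by (intro mult_right_mono) auto
      ultimately show ?thesis using fin[OF e(4)] by simp
    next
      case False
      define y where "y = real (k - card e0) / real k"
      have "(y - \<alpha>) * real n \<le> real (card D)"
        unfolding D_def y_def using False c0 e(3,4) e0J disj0
        by (intro partite_min_degreeD[OF d[of "card e0"]]) (auto simp: layer_def)
      moreover have "x * real n \<le> y * real n"
        using c0 unfolding x_def y_def by (intro mult_right_mono divide_right_mono) auto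
      moreover have "x * real a \<le> (1 - 1 / real k) * real a" using x1 by (intro mult_right_mono) auto
      moreover have "(1 - 1 / real k) * real a = real a - real a / real k" by (simp add: algebra_simps)
      moreover have "2 * (\<alpha> * real n) \<le> real a / real k" using a(1) k1 by (simp add: field_simps)
      moreover have "\<alpha> * real a \<le> \<alpha> * real n" using a(2) \<alpha> by simp
      moreover have "(y - \<alpha>) * real n = y * real n - \<alpha> * real n" by (simp add: algebra_simps)
      moreover have "(x + \<alpha> / 2) * (real n + real a) = x * real n + x * real a + \<alpha> * real n / 2 + \<alpha> * real a / 2"
        by (simp add: algebra_simps)
      ultimately show ?thesis by linarith
    qed
    moreover have "real (card D) + real a \<le> real (card {v \<in> padded_part a V i. insert v e \<in> padded_system a V r J})"
      using of_nat_mono[OF low, where 'a = real] by simp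
    ultimately show ?thesis unfolding x_def of_nat_add by linarith
  qed
qed

section \<open>From the padded system back to the original one\<close>

theorem theorem2p4:
  fixes k r :: nat
  assumes "0 < k" "k \<le> r"
  shows "\<exists>\<alpha>0::real. \<alpha>0 > 0 \<and>
    (\<forall>\<alpha>::real. 0 < \<alpha> \<and> \<alpha> < \<alpha>0 \<longrightarrow>
      (\<exists>n0::nat. \<forall>n\<ge>n0. \<forall>(V :: nat \<Rightarrow> 'a set) (J :: 'a set set).
         equi_partition V r n \<and>
         k_system k (vertex_set V r) J \<and>
         partite V r J \<and>
         partite_min_degree V r J 0 \<ge> ereal (real n) \<and>
         (\<forall>j. 1 \<le> j \<and> j \<le> k - 1 \<longrightarrow>
             partite_min_degree V r J j \<ge> ereal ((real (k - j) / real k - \<alpha>) * real n))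
         \<longrightarrow> (\<exists>M. M \<subseteq> layer J k \<and> matching M \<and>
                 real (card (vertex_set V r - \<Union>M)) \<le> 9 * real k ^ 2 * real r * \<alpha> * real n)))"
proof (intro exI[of _ "1 / (4 * real k)"] conjI allI impI)
  \<comment> \<open>The threshold \<open>1 / (4 * k)\<close>, together with
    \<open>1 \<le> k * \<alpha> * n\<close>, makes the padding size satisfy
    \<open>a \<le> 3 * k * \<alpha> * n \<le> n\<close>.\<close>
  show "0 < 1 / (4 * real k)" using assms by simp
  fix \<alpha> :: real assume "0 < \<alpha> \<and> \<alpha> < 1 / (4 * real k)"
  then have \<alpha>: "0 < \<alpha>" "\<alpha> \<le> 1 / (4 * real k)" by auto
  have k1: "1 \<le> real k" using assms by simp
  then have "1 / (4 * real k) \<le> 1" by (simp add: field_simps)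
  then have \<alpha>1: "\<alpha> \<le> 1" using \<alpha> by linarith
  have k\<alpha>: "4 * real k * \<alpha> \<le> 1" using \<alpha> k1 by (simp add: field_simps)
  \<comment> \<open>Padding leaves the slack \<open>\<alpha> / 2\<close>; with
    \<open>\<gamma> = \<alpha>\<close> the uncovered proportion is of the order of the allowed
    error.\<close>
  have "\<forall>\<^sub>F n in sequentially. \<forall>(V :: nat \<Rightarrow> ('a + nat \<times> nat) set) J. slack_partite_system V J k r n (\<alpha> / 2) \<longrightarrow>
      (\<exists>M. M \<subseteq> layer J k \<and> matching M \<and> real (card ((\<Union>i<r. V i) - \<Union>M)) \<le> real r * (\<alpha> * real n + real k))"
    using \<alpha> \<alpha>1 assms by (intro almost_perfect_matching) auto
  then obtain n1 where n1: "\<forall>n\<ge>n1. \<forall>(V :: nat \<Rightarrow> ('a + nat \<times> nat) set) J. slack_partite_system V J k r n (\<alpha> / 2) \<longrightarrow>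
      (\<exists>M. M \<subseteq> layer J k \<and> matching M \<and> real (card ((\<Union>i<r. V i) - \<Union>M)) \<le> real r * (\<alpha> * real n + real k))"
    unfolding eventually_sequentially by blast
  show "\<exists>n0. \<forall>n\<ge>n0. \<forall>(V :: nat \<Rightarrow> 'a set) (J :: 'a set set).
         equi_partition V r n \<and>
         k_system k (vertex_set V r) J \<and>
         partite V r J \<and>
         partite_min_degree V r J 0 \<ge> ereal (real n) \<and>
         (\<forall>j. 1 \<le> j \<and> j \<le> k - 1 \<longrightarrow>
             partite_min_degree V r J j \<ge> ereal ((real (k - j) / real k - \<alpha>) * real n))
         \<longrightarrow> (\<exists>M. M \<subseteq> layer J k \<and> matching M \<and>
                 real (card (vertex_set V r - \<Union>M)) \<le> 9 * real k ^ 2 * real r * \<alpha> * real n)"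
  \<comment> \<open>Beyond \<open>1 / \<alpha>\<close> one has \<open>1 \<le> \<alpha> * n\<close>,
    which absorbs the rounding in \<open>a\<close> and the additive \<open>k\<close>.\<close>
  proof (intro exI[of _ "max n1 (nat \<lceil>1 / \<alpha>\<rceil>)"] allI impI, elim conjE)
    fix n and V :: "nat \<Rightarrow> 'a set" and J
    assume n: "max n1 (nat \<lceil>1 / \<alpha>\<rceil>) \<le> n"
      and V: "equi_partition V r n" and J: "k_system k (vertex_set V r) J"
      and d0: "partite_min_degree V r J 0 \<ge> ereal (real n)"
      and d: "\<forall>j. 1 \<le> j \<and> j \<le> k - 1 \<longrightarrow>
             partite_min_degree V r J j \<ge> ereal ((real (k - j) / real k - \<alpha>) * real n)"
    have "1 / \<alpha> \<le> real n" using n by linarith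
    then have n\<alpha>: "1 \<le> \<alpha> * real n" using \<alpha> by (simp add: field_simps)
    have kan: "4 * (real k * (\<alpha> * real n)) \<le> real n"
      using mult_right_mono[OF k\<alpha>, of "real n"] by (simp add: mult.assoc)
    define a where "a = nat \<lceil>2 * (real k * (\<alpha> * real n))\<rceil>"
    have kan1: "1 \<le> real k * (\<alpha> * real n)" using mult_mono[OF k1 n\<alpha>] by simp
    have a1: "2 * (real k * (\<alpha> * real n)) \<le> real a" unfolding a_def by linarith
    have a2: "real a \<le> 2 * (real k * (\<alpha> * real n)) + 1" unfolding a_def using kan1 by linarith
    have an: "a \<le> n" using a2 kan kan1 by linarith
    define V' where "V' = padded_part a V"
    define J' where "J' = padded_system a V r J"
    define U where "U = (\<Union>i<r. V' i)"
    have sys: "slack_partite_system V' J' k r (n + a) (\<alpha> / 2)"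
      unfolding V'_def J'_def
      by (rule padded_slack_system[OF assms V J d0 _ \<alpha> _ an]) (use d a1 kan1 kan in \<open>auto simp: mult.assoc\<close>)
    interpret slack_partite_system V' J' k r "n + a" "\<alpha> / 2" by (rule sys)
    obtain M' where M': "M' \<subseteq> layer J' k" "matching M'"
      and cM': "real (card (U - \<Union>M')) \<le> real r * (\<alpha> * real (n + a) + real k)"
      using n1[rule_format, OF _ sys] n unfolding U_def by (metis max.bounded_iff trans_le_add1)
    have finU: "finite U" using finite_vertices by (simp add: U_def)
    have M'U: "e \<subseteq> U" "card e = k" "finite e" if "e \<in> M'" for e
    proof -
      have "e \<in> J'" using that M' by (auto simp: layer_def)
      then show "e \<subseteq> U" "finite e" using edge_subset finite_edge by (auto simp: U_def)
      show "card e = k" using that M' by (auto simp: layer_def)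
    qed
    have "finite M'" using finU M'U(1) by (intro finite_subset[of M' "Pow U"]) auto
    define F :: "('a + nat \<times> nat) set" where "F = Inr ` ({..<r} \<times> {..<a})"
    \<comment> \<open>The edges to discard: at most one per padding vertex, hence at most
      \<open>r * a\<close> edges, which together cover at most \<open>r * a * k\<close>
      vertices.\<close>
    define B where "B = {e \<in> M'. e \<inter> F \<noteq> {}}"
    have finB: "finite B" using \<open>finite M'\<close> by (simp add: B_def)
    have "card B \<le> card F"
      using M'(2) by (intro card_matching_meeting_le) (auto simp: B_def F_def matching_def)
    also have "card F = r * a" by (simp add: F_def card_image card_cartesian_product)
    finally have cB: "card B \<le> r * a" .
    have "card (\<Union>B) \<le> (\<Sum>e\<in>B. card e)" using card_UN_le[OF finB, of "\<lambda>e. e"] by simp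
    also have "\<dots> = card B * k" using M'U(2) by (simp add: B_def)
    finally have cUB: "card (\<Union>B) \<le> r * a * k" using cB by (meson mult_le_mono1 order_trans)
    define M where "M = (\<lambda>e. Inl -` e) ` (M' - B)"
    \<comment> \<open>An edge avoiding \<open>F\<close> consists of \<open>Inl\<close> vertices
      only, so pulling it back keeps its size \<open>k\<close>.\<close>
    have img: "e = Inl ` (Inl -` e)" if "e \<in> M' - B" for e
    proof -
      have "e \<subseteq> range Inl"
        using that M'U(1)[of e] by (force simp: B_def F_def U_def V'_def padded_part_def)
      then show ?thesis by auto
    qed
    have "M \<subseteq> layer J k"
    proof
      fix e assume "e \<in> M"
      then obtain e' where e': "e' \<in> M' - B" "e = Inl -` e'" by (auto simp: M_def)
      then have "e \<in> J" using M' by (auto simp: layer_def J'_def padded_system_def)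
      moreover have "card e = card (Inl ` e :: ('a + nat \<times> nat) set)" by (simp add: card_image)
      then have "card e = card e'" using img[OF e'(1)] e'(2) by simp
      ultimately show "e \<in> layer J k" using M'U(2) e' by (auto simp: layer_def)
    qed
    moreover have "matching M"
      using M'(2) unfolding M_def matching_def by auto
    moreover have "real (card (vertex_set V r - \<Union>M)) \<le> 9 * real k ^ 2 * real r * \<alpha> * real n"
    proof -
      have "Inl ` (vertex_set V r - \<Union>M) \<subseteq> (U - \<Union>M') \<union> \<Union>B"
        by (auto simp: vertex_set_def M_def U_def V'_def padded_part_def)
      moreover have "finite (\<Union>B)" using finB M'U(3) by (auto simp: B_def)
      ultimately have "card (Inl ` (vertex_set V r - \<Union>M) :: ('a + nat \<times> nat) set) \<le> card ((U - \<Union>M') \<union> \<Union>B)"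
        using finU by (intro card_mono) auto
      also have "\<dots> \<le> card (U - \<Union>M') + card (\<Union>B)" by (rule card_Un_le)
      finally have "card (vertex_set V r - \<Union>M) \<le> card (U - \<Union>M') + r * a * k"
        using cUB by (simp add: card_image)
      then have "real (card (vertex_set V r - \<Union>M)) \<le> real (card (U - \<Union>M')) + real (r * a * k)"
        by (metis of_nat_add of_nat_mono)
      also have "\<dots> \<le> real r * (\<alpha> * real (n + a) + real k + real a * real k)"
        using cM' by (simp add: algebra_simps)
      \<comment> \<open>With \<open>x = \<alpha> * n \<ge> 1\<close>, the three terms are at most
        \<open>2\<close>, \<open>1\<close> and \<open>3\<close> times \<open>k^2 * x\<close>, within
        the required \<open>9\<close>.\<close>
      also have "\<dots> \<le> real r * (9 * real k ^ 2 * (\<alpha> * real n))"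
      proof (rule mult_left_mono)
        define x where "x = \<alpha> * real n"
        have "\<alpha> * real (n + a) \<le> 2 * x"
          using an \<alpha> by (simp add: x_def algebra_simps)
        moreover have "real a * real k \<le> (2 * (real k * x) + 1) * real k"
          using a2 unfolding x_def by (intro mult_right_mono) auto
        moreover have "real k \<le> real k ^ 2 * x" "x \<le> real k ^ 2 * x"
        proof -
          have x: "1 \<le> x" using n\<alpha> by (simp add: x_def)
          have k2: "real k \<le> real k ^ 2" using k1 by (simp add: power2_eq_square)
          show "real k \<le> real k ^ 2 * x" using mult_mono[OF k2 x] by simp
          have "1 \<le> real k ^ 2" using k2 k1 by linarith
          then show "x \<le> real k ^ 2 * x" using mult_right_mono[of 1 "real k ^ 2" x] x by simp
        qed
        ultimately show "\<alpha> * real (n + a) + real k + real a * real k \<le> 9 * real k ^ 2 * (\<alpha> * real n)"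
          unfolding x_def[symmetric] by (simp add: algebra_simps power2_eq_square)
      qed simp
      finally show ?thesis by (simp add: mult_ac)
    qed
    ultimately show "\<exists>M. M \<subseteq> layer J k \<and> matching M \<and>
        real (card (vertex_set V r - \<Union>M)) \<le> 9 * real k ^ 2 * real r * \<alpha> * real n" by blast
  qed
qed

end
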